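(* Let $F$ be a finite field with $f$ elements, let $q$ be a non-degenerate quadratic form of dimension $2$ over $F$ and let $a\in\widetilde{\mathsf D}(q)$. The number of cycles of length $4$ in $\mathcal{G}_{q,a}$ is: (i) if $a\ne 0$ and $q$ is isotropic: $\frac{f^2(f-1)(f-3)}{8}$ if $\mathrm{char}(F)\ne 2$ and $\frac{f^2(f-1)(f-2)}{8}$ if $\mathrm{char}(F)=2$; (ii) if $a\ne0$ and $q$ is anisotropic: $\frac{f^2(f+1)(f-1)}{8}$ if $\mathrm{char}(F)\neq2$ and $\frac{f^3(f+1)}{8}$ if $\mathrm{char}(F)=2$; (iii) if $a=0$ (so $q$ is isotropic): $\frac{f^2}{4}\left(6\binom{f-1}{3}+(f-1)^2\right)$.
   Context: A quadratic form on a finite-dimensional $F$-vector space $V$ is a map $q:V\to F$ with $q(\lambda x)=\lambda^2q(x)$ such that $b_q(x,y)=q(x+y)-q(x)-q(y)$ is bilinear; non-degenerate means $\{x: b_q(x,y)=0\ \forall y\}=\{0\}$. $q$ is isotropic if $q(v)=0$ for some $v\ne0$. $\mathsf D(q)=\{q(v):v\in V\}\cap F^\ast$; $\widetilde{\mathsf D}(q)=\mathsf D(q)\cup\{0\}$ if $q$ is isotropic and $=\mathsf D(q)$ otherwise. The representation graph $\mathcal{G}_{q,a}$ has vertex set $V$, with distinct $x,y$ adjacent iff $q(x-y)=a$. A cycle of length $n$ is given by pairwise distinct vertices $v_0,\dots,v_{n-1}$ with $v_{i-1},v_i$ adjacent (indices mod $n$); cycles are counted as subgraphs, i.e. up to cyclic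 rotation and reversal of the sequence. *)

theory Defs
  imports Complex_Main "HOL-Library.Cardinality" "HOL-Computational_Algebra.Computational_Algebra"
begin

definition polar_form :: "('v::ab_group_add \<Rightarrow> 'f::field) \<Rightarrow> 'v \<Rightarrow> 'v \<Rightarrow> 'f" where
  "polar_form q x y = q (x + y) - q x - q y"

definition quadratic_form :: "('f::field \<Rightarrow> 'v::ab_group_add \<Rightarrow> 'v) \<Rightarrow> ('v \<Rightarrow> 'f) \<Rightarrow> bool" where
  "quadratic_form scale q \<longleftrightarrow>
     (\<forall>c x. q (scale c x) = c\<^sup>2 * q x) \<and>
     (\<forall>y. Vector_Spaces.linear scale (*) (\<lambda>x. polar_form q x y)) \<and>
     (\<forall>x. Vector_Spaces.linear scale (*) (\<lambda>y. polar_form q x y))"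

definition nondegenerate :: "('v::ab_group_add \<Rightarrow> 'f::field) \<Rightarrow> bool" where
  "nondegenerate q \<longleftrightarrow> {x. \<forall>y. polar_form q x y = 0} = {0}"

definition isotropic :: "('v::ab_group_add \<Rightarrow> 'f::field) \<Rightarrow> bool" where
  "isotropic q \<longleftrightarrow> (\<exists>v. v \<noteq> 0 \<and> q v = 0)"

definition represented :: "('v::ab_group_add \<Rightarrow> 'f::field) \<Rightarrow> 'f set" where
  "represented q = range q \<inter> {c. c \<noteq> 0}"

definition represented_ext :: "('v::ab_group_add \<Rightarrow> 'f::field) \<Rightarrow> 'f set" where
  "represented_ext q = (if isotropic q then represented q \<union> {0} else represented q)"

text \<open>A simple graph is a pair of a vertex set and a set of two-element edges.\<close>

type_synonym 'v graph = "'v set \<times> 'v set set"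

text \<open>For a quadratic form \<open>q\<close> one has \<open>q (x - y) = q (y - x)\<close>, so adjacency is symmetric
  and unordered edges lose nothing.\<close>

definition representation_graph :: "('v::ab_group_add \<Rightarrow> 'f::field) \<Rightarrow> 'f \<Rightarrow> 'v graph" where
  "representation_graph q a = (UNIV, {{x, y} |x y. x \<noteq> y \<and> q (x - y) = a})"

definition cycle_seq :: "'v graph \<Rightarrow> nat \<Rightarrow> 'v list \<Rightarrow> bool" where
  "cycle_seq G n vs \<longleftrightarrow>
     length vs = n \<and> distinct vs \<and> set vs \<subseteq> fst G \<and>
     (\<forall>i<n. {vs ! i, vs ! ((i + 1) mod n)} \<in> snd G)"

definition cycle_subgraph :: "'v list \<Rightarrow> 'v graph" where
  "cycle_subgraph vs =
     (set vs, {{vs ! i, vs ! ((i + 1) mod length vs)} |i. i < length vs})"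

text \<open>For \<open>n \<ge> 3\<close>, two cycle sequences trace out the same subgraph precisely when they
  differ by a cyclic rotation and possibly a reversal.\<close>

definition cycles :: "'v graph \<Rightarrow> nat \<Rightarrow> 'v graph set" where
  "cycles G n = cycle_subgraph ` {vs. cycle_seq G n vs}"

end

(* For a \<noteq> 0, every 4-cycle is a parallelogram v, v + s, v + s + t, v + t with q s = q t = a and
   s \<noteq> t, s \<noteq> - t, because the conic q = a meets a translate of itself in at most two points.
   So it remains to count the points of that conic: f - 1 of them on a hyperbola (read off from
   hyperbolic coordinates), f + 1 in the anisotropic case (stereographic projection).
   For a = 0 the neighbours of 0 form two lines, and 4-cycles are counted directly in
   hyperbolic coordinates. Every 4-cycle arises from 8 vertex sequences. *)

theory Submission
  imports Defs
begin

section \<open>Vertex sequences of 4-cycles\<close>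

lemma quadruple_cycle_subgraph_eq_iff:
  assumes "distinct [v0, v1, v2, v3]" "distinct [w0, w1, w2, w3]"
  shows "cycle_subgraph [w0, w1, w2, w3] = cycle_subgraph [v0, v1, v2, v3] \<longleftrightarrow>
    [w0, w1, w2, w3] \<in> {[v0, v1, v2, v3], [v1, v2, v3, v0], [v2, v3, v0, v1], [v3, v0, v1, v2],
      [v3, v2, v1, v0], [v2, v1, v0, v3], [v1, v0, v3, v2], [v0, v3, v2, v1]}"
proof -
  have edges: "cycle_subgraph [x0, x1, x2, x3] =
      ({x0, x1, x2, x3}, {{x0, x1}, {x1, x2}, {x2, x3}, {x3, x0}})" for x0 x1 x2 x3 :: 'a
  proof -
    have "{h i |i. i < length [x0, x1, x2, x3]} = {h 0, h 1, h 2, h 3}" for h :: "nat \<Rightarrow> 'a set"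
      by (auto simp: numeral_eq_Suc less_Suc_eq)
    then show ?thesis
      unfolding cycle_subgraph_def by (simp add: insert_commute)
  qed
  show ?thesis
  proof
    assume "cycle_subgraph [w0, w1, w2, w3] = cycle_subgraph [v0, v1, v2, v3]"
    then have eq: "{{w0, w1}, {w1, w2}, {w2, w3}, {w3, w0}} = {{v0, v1}, {v1, v2}, {v2, v3}, {v3, v0}}"
      unfolding edges by (rule Pair_inject)
    have E: "{{w0, w1}, {w1, w2}, {w2, w3}} \<subseteq> {{v0, v1}, {v1, v2}, {v2, v3}, {v3, v0}}"
      unfolding eq[symmetric] by simp
    then have "{w0, w1} \<in> {{v0, v1}, {v1, v2}, {v2, v3}, {v3, v0}}"
      by blast
    \<comment> \<open>The first edge can land on any of four edges in two orientations. Once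
      \<open>w0\<close> and \<open>w1\<close> are placed, distinctness forces the other two vertices
      along the next two edges.\<close>
    then consider "w0 = v0" "w1 = v1" | "w0 = v1" "w1 = v0" | "w0 = v1" "w1 = v2" | "w0 = v2" "w1 = v1"
      | "w0 = v2" "w1 = v3" | "w0 = v3" "w1 = v2" | "w0 = v3" "w1 = v0" | "w0 = v0" "w1 = v3"
      by (auto simp: doubleton_eq_iff)
    then show "[w0, w1, w2, w3] \<in> {[v0, v1, v2, v3], [v1, v2, v3, v0], [v2, v3, v0, v1],
        [v3, v0, v1, v2], [v3, v2, v1, v0], [v2, v1, v0, v3], [v1, v0, v3, v2], [v0, v3, v2, v1]}"
      using E assms by cases (auto simp: doubleton_eq_iff)
  qed (elim insertE emptyE; simp add: edges insert_commute)
qed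

lemma cycle_seq_4_iff:
  "cycle_seq G 4 vs \<longleftrightarrow> (\<exists>v0 v1 v2 v3. vs = [v0, v1, v2, v3] \<and> distinct vs \<and> set vs \<subseteq> fst G \<and>
     {v0, v1} \<in> snd G \<and> {v1, v2} \<in> snd G \<and> {v2, v3} \<in> snd G \<and> {v3, v0} \<in> snd G)"
proof -
  have len: "length vs = 4 \<longleftrightarrow> (\<exists>v0 v1 v2 v3. vs = [v0, v1, v2, v3])"
    by (simp add: numeral_eq_Suc length_Suc_conv) blast
  have all: "(\<forall>i<4. P i) \<longleftrightarrow> P 0 \<and> P 1 \<and> P 2 \<and> P 3" for P :: "nat \<Rightarrow> bool"
    by (auto simp: numeral_eq_Suc less_Suc_eq)
  show ?thesis
    unfolding cycle_seq_def len all by (rule iffI; elim exE conjE; simp)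
qed

text \<open>Double counting along \<open>cycle_subgraph\<close>: each fibre is one orbit of the
  dihedral group of the square, and its eight sequences differ because the vertices are
  distinct.\<close>

lemma card_cycle_seq_4:
  assumes "finite (fst G)"
  shows "card {vs. cycle_seq G 4 vs} = 8 * card (cycles G 4)"
proof -
  let ?S = "{vs. cycle_seq G 4 vs}"
  have fin: "finite ?S"
    by (rule finite_subset[OF _ finite_lists_length_eq[OF assms, of 4]]) (auto simp: cycle_seq_def)
  have fiber: "card {vs \<in> ?S. cycle_subgraph vs = C} = 8" if C: "C \<in> cycles G 4" for C
  proof -
    obtain us where us: "C = cycle_subgraph us" "cycle_seq G 4 us"
      using C unfolding cycles_def by blast
    then obtain v0 v1 v2 v3 where "us = [v0, v1, v2, v3]"
      unfolding cycle_seq_4_iff by blast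
    with us have v: "C = cycle_subgraph [v0, v1, v2, v3]" "cycle_seq G 4 [v0, v1, v2, v3]"
      by simp_all
    then have d: "distinct [v0, v1, v2, v3]"
      by (simp add: cycle_seq_def)
    let ?R = "{[v0, v1, v2, v3], [v1, v2, v3, v0], [v2, v3, v0, v1], [v3, v0, v1, v2],
      [v3, v2, v1, v0], [v2, v1, v0, v3], [v1, v0, v3, v2], [v0, v3, v2, v1]}"
    have "?R \<subseteq> ?S"
      using v(2) by (auto simp: cycle_seq_4_iff insert_commute)
    moreover have "vs \<in> ?R \<longleftrightarrow> cycle_subgraph vs = C" if vs: "cycle_seq G 4 vs" for vs
    proof -
      obtain w0 w1 w2 w3 where w: "vs = [w0, w1, w2, w3]"
        using vs unfolding cycle_seq_4_iff by blast
      moreover have "distinct [w0, w1, w2, w3]"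
        using vs w by (simp add: cycle_seq_def)
      ultimately show ?thesis
        using quadruple_cycle_subgraph_eq_iff[OF d] v(1) by simp
    qed
    ultimately have "{vs \<in> ?S. cycle_subgraph vs = C} = ?R"
      by blast
    also have "card ?R = 8"
      using d by (simp add: card_insert_if)
    finally show ?thesis .
  qed
  have "card ?S = (\<Sum>C\<in>cycles G 4. card {vs \<in> ?S. cycle_subgraph vs = C})"
    using sum.image_gen[OF fin, of "\<lambda>_. 1 :: nat" cycle_subgraph] by (simp add: cycles_def)
  also have "\<dots> = 8 * card (cycles G 4)"
    using fiber by simp
  finally show ?thesis .
qed

text \<open>Counts the 4-cycles through 0 inside an axis when a = 0. Truncated subtraction is
  harmless: if \<open>A\<close> has fewer than three elements, some factor is 0.\<close>

lemma card_distinct_triples: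
  assumes "finite A"
  shows "card {(x, y, z). x \<in> A \<and> y \<in> A \<and> z \<in> A \<and> x \<noteq> y \<and> x \<noteq> z \<and> y \<noteq> z} =
    card A * (card A - 1) * (card A - 2)"
proof -
  have "{(x, y, z). x \<in> A \<and> y \<in> A \<and> z \<in> A \<and> x \<noteq> y \<and> x \<noteq> z \<and> y \<noteq> z} =
      (SIGMA x:A. SIGMA y:A - {x}. A - {x, y})"
    by auto
  moreover have "card (A - {x, y}) = card A - 2" if "x \<in> A" "y \<in> A - {x}" for x y
    using that assms by (subst card_Diff_subset) auto
  then have "card (SIGMA y:A - {x}. A - {x, y}) = (card A - 1) * (card A - 2)" if "x \<in> A" for x
    using that assms by (subst card_SigmaI) auto
  ultimately show ?thesis
    using assms by (simp add: mult.assoc)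
qed

section \<open>Non-degenerate quadratic planes: coordinates and orthogonality\<close>

locale quadratic_plane = vector_space scale
  for scale :: "'f::field \<Rightarrow> 'v::ab_group_add \<Rightarrow> 'v" (infixr \<open>*s\<close> 75) +
  fixes q :: "'v \<Rightarrow> 'f"
  assumes dim_2: "dim UNIV = 2"
    and quadratic: "quadratic_form scale q"
    and nondeg: "nondegenerate q"
begin

abbreviation b :: "'v \<Rightarrow> 'v \<Rightarrow> 'f" where "b \<equiv> polar_form q"

lemma q_scale [simp]: "q (c *s x) = c\<^sup>2 * q x"
  using quadratic by (simp add: quadratic_form_def)

lemma q_zero [simp]: "q 0 = 0"
  using q_scale[of 0 0] by simp

lemma q_minus [simp]: "q (- x) = q x"
  using q_scale[of "-1" x] by simp

lemma q_minus_commute: "q (x - y) = q (y - x)"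
  using q_minus[of "x - y"] by simp

lemma b_commute: "b x y = b y x"
  by (simp add: polar_form_def add.commute)

lemma b_add_left: "b (x + y) z = b x z + b y z"
  and b_scale_left [simp]: "b (c *s x) z = c * b x z"
  using quadratic by (auto simp: quadratic_form_def Vector_Spaces.linear_iff)

lemma b_scale_right [simp]: "b z (c *s x) = c * b z x"
  by (metis b_commute b_scale_left)

lemma b_minus_left [simp]: "b (- x) z = - b x z"
  using b_scale_left[of "-1" x z] by simp

lemma b_minus_right [simp]: "b z (- x) = - b z x"
  by (metis b_commute b_minus_left)

lemma b_diff_left: "b (x - y) z = b x z - b y z"
  using b_add_left[of x "- y" z] by simp

lemma b_diff_right: "b z (x - y) = b z x - b z y"
  by (metis b_commute b_diff_left)

lemma b_self: "b x x = 2 * q x"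
proof -
  have "x + x = 2 *s x"
    using scale_left_distrib[of 1 1 x] by simp
  then have "q (x + x) = 4 * q x"
    by simp
  then show ?thesis
    by (simp add: polar_form_def)
qed

lemma q_add: "q (x + y) = q x + q y + b x y"
  by (simp add: polar_form_def)

lemma q_diff: "q (x - y) = q x + q y - b x y"
  using q_add[of x "- y"] by simp

lemma b_radical: "(\<And>y. b x y = 0) \<Longrightarrow> x = 0"
  using nondeg by (auto simp: nondegenerate_def)

lemma bij_coordinates:
  assumes "v \<noteq> 0" "\<And>c. u \<noteq> c *s v"
  shows "bij (\<lambda>(x, y). x *s u + y *s v)"
proof -
  obtain B where B: "independent B" "UNIV \<subseteq> span B" "card B = 2"
    using basis_exists[of UNIV] dim_2 by metis
  \<comment> \<open>An infinite set has \<open>card\<close> 0, so \<open>card B = 2\<close> makes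
    the basis finite.\<close>
  interpret finite_dimensional_vector_space scale B
    using B by unfold_locales (auto intro: card_ge_0_finite)
  have u: "u \<notin> span {v}"
    using assms(2) by (auto simp: span_singleton)
  moreover have "u \<noteq> v"
    using assms(2)[of 1] by simp
  ultimately have "UNIV \<subseteq> span {u, v}"
    using assms(1) by (intro card_ge_dim_independent) (auto simp: independent_insert dim_2 simp del: dim_UNIV)
  then have "\<exists>x. w - x *s u \<in> span {v}" for w
    by (auto simp: span_insert[of u])
  then have "\<exists>x y. w = x *s u + y *s v" for w
    unfolding span_singleton image_iff by (metis add.commute diff_add_cancel)
  moreover have "x = x' \<and> y = y'" if "x *s u + y *s v = x' *s u + y' *s v" for x y x' y'
  proof -
    have *: "(x - x') *s u = (y' - y) *s v"
      using that by (simp add: scale_left_diff_distrib algebra_simps)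
    have "x = x'"
    proof (rule ccontr)
      assume "x \<noteq> x'"
      then have "u = inverse (x - x') *s ((x - x') *s u)"
        by simp
      then have "u = (inverse (x - x') * (y' - y)) *s v"
        unfolding * by simp
      then show False
        using assms(2) by blast
    qed
    then show ?thesis
      using * assms(1) by simp
  qed
  ultimately show ?thesis
    by (auto simp: bij_def inj_def surj_def) 
qed

lemma coordinates:
  assumes "v \<noteq> 0" "\<And>c. u \<noteq> c *s v"
  obtains x y where "w = x *s u + y *s v"
  using bij_coordinates[OF assms] by (force simp: bij_def surj_def)

lemma q_coordinates: "q (x *s u + y *s v) = x\<^sup>2 * q u + x * y * b u v + y\<^sup>2 * q v"
  by (simp add: q_add algebra_simps)

text \<open>The orthogonal complement of a nonzero \<open>d\<close> is at most a line: two
  independent vectors in it would span the plane and put \<open>d\<close> into the radical.\<close>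

lemma orthogonal_proportional:
  assumes "d \<noteq> 0" "b u d = 0" "b v d = 0" "v \<noteq> 0"
  obtains c where "u = c *s v"
proof (rule ccontr)
  assume "\<not> thesis"
  then have "\<And>c. u \<noteq> c *s v"
    using that by blast
  then have "b w d = 0" for w
    using coordinates[of v u w] assms by (metis b_add_left b_scale_left add_0 mult_zero_right)
  then show False
    using b_radical[of d] b_commute assms(1) by metis
qed

text \<open>If \<open>w\<close> were nonzero, then \<open>w\<close> and \<open>s\<close> would both
  be orthogonal to \<open>w\<close>, since b(w,w) = 2 q(w) = 0. So \<open>s\<close> would be a
  multiple of \<open>w\<close> and q(s) = 0.\<close>

lemma isotropic_orthogonal_eq_0:
  assumes "q w = 0" "b w s = 0" "q s \<noteq> 0"
  shows "w = 0"
proof (rule ccontr)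
  assume "w \<noteq> 0"
  with assms obtain c where "s = c *s w"
    by (metis orthogonal_proportional b_commute b_self mult_zero_right)
  with assms show False by simp
qed

text \<open>Both \<open>w\<close> and \<open>s + t\<close> are orthogonal to \<open>s - t\<close>, hence proportional.\<close>

lemma four_cycle_parallelogram:
  assumes "q s = a" "q t = a" "q (w - s) = a" "q (w - t) = a" "a \<noteq> 0" "w \<noteq> 0" "s \<noteq> t"
  shows "w = s + t"
proof -
  have ws: "b w s = q w" and wt: "b w t = q w"
    using assms by (simp_all add: q_diff)
  have wd: "b w (s - t) = 0"
    using ws wt by (simp add: b_diff_right)
  have sd: "b (s + t) (s - t) = 0"
    using assms by (simp add: b_diff_right b_add_left b_self b_commute[of t s])
  \<comment> \<open>If t = -s, the two values of b(w, -) give q(w) = -q(w), while s \<noteq> -s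
    excludes characteristic 2. So \<open>w\<close> is isotropic and orthogonal to \<open>s\<close>,
    hence 0.\<close>
  have "s + t \<noteq> 0"
  proof
    assume "s + t = 0"
    then have t: "t = - s"
      by (simp add: eq_neg_iff_add_eq_0 add.commute)
    then have "q w = - q w"
      using ws wt by simp
    moreover have "s \<noteq> - s"
      using t assms(7) by simp
    then have "(2::'f) \<noteq> 0"
      by (metis add.inverse_unique one_add_one scale_left_distrib scale_one scale_zero_left)
    ultimately have "q w = 0"
      by (metis add.right_inverse mult_2 mult_eq_0_iff)
    then show False
      using isotropic_orthogonal_eq_0[of w s] ws assms by simp
  qed
  then obtain c where c: "w = c *s (s + t)"
    using orthogonal_proportional[of "s - t" w "s + t"] wd sd assms(7) by auto
  \<comment> \<open>Both \<open>w\<close> and \<open>s + t\<close> satisfy b(x,s) = q(x). Comparing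
    a linear with a quadratic expression in \<open>c\<close> leaves c = c^2 once q(s + t) is
    nonzero.\<close>
  have bs: "b (s + t) s = q (s + t)"
    using assms by (simp add: b_add_left q_add b_self b_commute[of t s])
  then have "q (s + t) \<noteq> 0"
    using isotropic_orthogonal_eq_0[of "s + t" s] \<open>s + t \<noteq> 0\<close> assms by auto
  moreover have "c * q (s + t) = c\<^sup>2 * q (s + t)"
    using ws bs c by simp
  ultimately have "c = c\<^sup>2"
    by simp
  moreover have "c \<noteq> 0"
    using c assms(6) by auto
  ultimately have "c = 1"
    by (simp add: power2_eq_square)
  then show ?thesis
    using c by simp
qed

text \<open>An isotropic \<open>u\<close> lies outside the radical, so some \<open>v\<close> has
  b(u,v) = 1. Subtracting q(v) u from \<open>v\<close> keeps this pairing and makes the vector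
  isotropic, without division by 2.\<close>

lemma hyperbolic_basis:
  assumes "isotropic q"
  obtains u v where "bij (\<lambda>(x, y). x *s u + y *s v)" "\<And>x y. q (x *s u + y *s v) = x * y"
proof -
  obtain u where u: "u \<noteq> 0" "q u = 0"
    using assms by (auto simp: isotropic_def)
  obtain v' where v': "b u v' \<noteq> 0"
    using b_radical u by blast
  define v where "v = inverse (b u v') *s v'"
  define w where "w = v - q v *s u"
  have uv: "b u v = 1"
    using v' by (simp add: v_def)
  have uw: "b u w = 1" "q w = 0"
    using uv u by (simp_all add: w_def b_diff_right b_self q_diff b_commute[of v u])
  have "b u u = 0"
    using u by (simp add: b_self)
  then have "w \<noteq> c *s u" for c
    using uw by auto
  then have "bij (\<lambda>(x, y). x *s w + y *s u)"
    using bij_coordinates u by blast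
  moreover have "q (x *s w + y *s u) = x * y" for x y
    using u uw by (simp add: q_coordinates b_commute[of w u])
  ultimately show thesis
    using that by blast
qed

lemma not_proportional:
  fixes v :: 'v
  assumes "v \<noteq> 0"
  obtains u where "\<And>c. u \<noteq> c *s v"
proof (rule ccontr)
  assume "\<not> thesis"
  then have "UNIV \<subseteq> span {v}"
    using that unfolding span_singleton by blast
  then have "dim UNIV = 1"
    using assms by (intro dim_unique[of "{v}"]) auto
  then show False
    using dim_2 by simp
qed

lemma card_plane:
  fixes v :: 'v
  assumes "v \<noteq> 0"
  shows "CARD('v) = (CARD('f))\<^sup>2"
proof -
  obtain u where "\<And>c. u \<noteq> c *s v"
    using not_proportional assms by blast
  then have "CARD('f \<times> 'f) = CARD('v)"
    using bij_betw_same_card[OF bij_coordinates[OF assms]] by blast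
  then show ?thesis
    by (simp add: card_prod power2_eq_square)
qed

section \<open>Reduction to 4-cycles through 0\<close>

text \<open>The 4-cycle sequences through \<open>0\<close>, without their first vertex.\<close>

definition rooted_cycles :: "'f \<Rightarrow> ('v \<times> 'v \<times> 'v) set" where
  "rooted_cycles a = {(s, w, t). q s = a \<and> q (w - s) = a \<and> q (w - t) = a \<and> q t = a \<and>
     distinct [0, s, w, t]}"

lemma edge_representation_graph_iff:
  "{x, y} \<in> snd (representation_graph q a) \<longleftrightarrow> x \<noteq> y \<and> q (x - y) = a"
  using q_minus_commute[of x y] by (auto simp: representation_graph_def doubleton_eq_iff)

lemma fst_representation_graph [simp]: "fst (representation_graph q a) = UNIV"
  by (simp add: representation_graph_def)

text \<open>Translations are automorphisms of the graph, so a 4-cycle sequence is determined by its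
  first vertex and its translate starting at 0.\<close>

lemma card_cycles_eq_rooted:
  assumes "finite (UNIV :: 'v set)"
  shows "8 * card (cycles (representation_graph q a) 4) = CARD('v) * card (rooted_cycles a)"
proof -
  let ?h = "\<lambda>(v, s, w, t). [v, v + s, v + w, v + t]"
  have "{vs. cycle_seq (representation_graph q a) 4 vs} = ?h ` (UNIV \<times> rooted_cycles a)"
  proof (intro set_eqI iffI)
    fix vs assume "vs \<in> {vs. cycle_seq (representation_graph q a) 4 vs}"
    then obtain v0 v1 v2 v3 where vs: "vs = [v0, v1, v2, v3]" "distinct [v0, v1, v2, v3]"
      "q (v0 - v1) = a" "q (v1 - v2) = a" "q (v2 - v3) = a" "q (v3 - v0) = a"
      by (auto simp: cycle_seq_4_iff edge_representation_graph_iff)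
    then have "(v0, v1 - v0, v2 - v0, v3 - v0) \<in> UNIV \<times> rooted_cycles a"
      using q_minus_commute[of v0 v1] q_minus_commute[of v1 v2] by (auto simp: rooted_cycles_def)
    moreover have "vs = ?h (v0, v1 - v0, v2 - v0, v3 - v0)"
      using vs by simp
    ultimately show "vs \<in> ?h ` (UNIV \<times> rooted_cycles a)"
      by blast
  next
    fix vs assume "vs \<in> ?h ` (UNIV \<times> rooted_cycles a)"
    then obtain v s w t where "vs = [v, v + s, v + w, v + t]" "(s, w, t) \<in> rooted_cycles a"
      by auto
    then show "vs \<in> {vs. cycle_seq (representation_graph q a) 4 vs}"
      using q_minus_commute[of s w]
      by (auto simp: cycle_seq_4_iff edge_representation_graph_iff rooted_cycles_def)
  qed
  moreover have "inj_on ?h (UNIV \<times> rooted_cycles a)"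
    by (auto simp: inj_on_def)
  ultimately have "card {vs. cycle_seq (representation_graph q a) 4 vs} = CARD('v) * card (rooted_cycles a)"
    by (simp add: card_image card_cartesian_product)
  then show ?thesis
    using card_cycle_seq_4[of "representation_graph q a"] assms by simp
qed

text \<open>By the parallelogram law for 4-cycles, the pair (s, t) determines the cycle. The
  exclusions are t = s and, because s + t must not be 0, t = -s; these coincide exactly in
  characteristic 2.\<close>

lemma card_rooted_cycles:
  assumes "finite (UNIV :: 'v set)" "a \<noteq> 0"
  shows "card (rooted_cycles a) =
    card {x. q x = a} * (card {x. q x = a} - (if (2::'f) = 0 then 1 else 2))"
proof -
  let ?S = "{x. q x = a}"
  have "rooted_cycles a = (\<lambda>(s, t). (s, s + t, t)) ` (SIGMA s:?S. ?S - {s, - s})"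
    using four_cycle_parallelogram assms(2)
    by (auto simp: rooted_cycles_def image_iff eq_neg_iff_add_eq_0 add.commute)
  moreover have "inj_on (\<lambda>(s, t). (s, s + t, t)) (SIGMA s:?S. ?S - {s, - s})"
    by (auto simp: inj_on_def)
  moreover have "card (?S - {s, - s}) = card ?S - (if (2::'f) = 0 then 1 else 2)" if "s \<in> ?S" for s
  proof -
    have "s \<noteq> 0"
      using that assms(2) by auto
    have "s = - s \<longleftrightarrow> 2 *s s = 0"
      using scale_left_distrib[of 1 1 s] by (simp add: eq_neg_iff_add_eq_0)
    then have "s = - s \<longleftrightarrow> (2::'f) = 0"
      using \<open>s \<noteq> 0\<close> by simp
    then have "card {s, - s} = (if (2::'f) = 0 then 1 else 2)"
      by (simp add: card_insert_if)
    then show ?thesis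
      using that by (subst card_Diff_subset) auto
  qed
  moreover have "finite ?S"
    using assms(1) by (rule finite_subset[rotated]) simp
  ultimately show ?thesis
    by (simp add: card_image)
qed

section \<open>Points of the conic q = a for nonzero a\<close>

lemma card_fiber_isotropic:
  assumes "isotropic q" "a \<noteq> 0"
  shows "card {x. q x = a} = CARD('f) - 1"
proof -
  obtain u v where g: "bij (\<lambda>(x, y). x *s u + y *s v)" "\<And>x y. q (x *s u + y *s v) = x * y"
    using hyperbolic_basis assms(1) by blast
  have "card {x. q x = a} = card ((\<lambda>(x, y). x *s u + y *s v) -` {x. q x = a})"
    using g(1) by (subst card_vimage_inj) (auto simp: bij_def)
  also have "(\<lambda>(x, y). x *s u + y *s v) -` {x. q x = a} = (\<lambda>x. (x, a / x)) ` (UNIV - {0})"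
    using assms(2) by (auto simp: g(2) image_iff)
  also have "card \<dots> = CARD('f) - 1"
    by (subst card_image) (auto simp: inj_on_def card_Diff_singleton)
  finally show ?thesis .
qed

text \<open>Stereographic projection of the conic \<open>q = a\<close> from a point \<open>s\<close> of it: the lines through \<open>s\<close>
  with direction \<open>t *s s + e\<close> meet the conic again unless they are tangent, that is,
  unless \<open>2 * a * t + b s e = 0\<close>.\<close>

lemma card_fiber_anisotropic:
  assumes "\<not> isotropic q" "a \<noteq> 0" "q s = a" "finite (UNIV :: 'f set)"
  shows "card {x. q x = a} = CARD('f) + 1"
proof -
  have s: "s \<noteq> 0"
    using assms by auto
  then obtain e where e: "\<And>c. e \<noteq> c *s s"
    using not_proportional by blast
  \<comment> \<open>The coefficient of \<open>e\<close> comes first: the base point \<open>s\<close>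
    is \<open>g (0, 1)\<close>, and y = 0 is the line through 0 and \<open>s\<close>.\<close>
  define g where "g = (\<lambda>(y, x). y *s e + x *s s)"
  define \<beta> where "\<beta> = b e s"
  define Q where "Q = (\<lambda>x y. a * x\<^sup>2 + \<beta> * x * y + q e * y\<^sup>2)"
  have bij: "bij g"
    unfolding g_def using bij_coordinates[OF s e] .
  have qg: "q (g (y, x)) = Q x y" for x y
    using assms(3) by (simp add: g_def Q_def \<beta>_def q_coordinates mult_ac)
  \<comment> \<open>\<open>Q t 1\<close> is the value of \<open>q\<close> at the nonzero vector
    \<open>t *s s + e\<close>; anisotropy makes the denominator in \<open>l\<close> nonzero.\<close>
  have Q1: "Q t 1 \<noteq> 0" for t
  proof -
    have "g (1, t) \<noteq> g (0, 0)"
      using bij by (simp add: bij_def inj_eq)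
    then show ?thesis
      using assms(1) qg[of 1 t] by (auto simp: isotropic_def g_def)
  qed
  let ?P = "{(y, x). Q x y = a}"
  let ?T = "{t. 2 * a * t + \<beta> \<noteq> 0}"
  define l where "l = (\<lambda>t. - (2 * a * t + \<beta>) / Q t 1)"
  \<comment> \<open>The point \<open>s + m *s (t *s s + e)\<close> has coordinates (m, 1 + m t). It
    lies on the conic iff m = 0 or m = \<open>l t\<close>.\<close>
  have line: "Q (1 + m * t) m = a + m * (2 * a * t + \<beta> + m * Q t 1)" for m t
    by (simp add: Q_def power2_eq_square algebra_simps)
  have "bij_betw (\<lambda>t. (l t, 1 + l t * t)) ?T {(y, x). Q x y = a \<and> y \<noteq> 0}"
  proof (rule bij_betw_byWitness[where f' = "\<lambda>(y, x). (x - 1) / y"])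
    show "\<forall>t\<in>?T. (case (l t, 1 + l t * t) of (y, x) \<Rightarrow> (x - 1) / y) = t"
      using Q1 by (auto simp: l_def)
    have *: "l ((x - 1) / y) = y \<and> 2 * a * ((x - 1) / y) + \<beta> \<noteq> 0" if "Q x y = a" "y \<noteq> 0" for x y
    proof -
      let ?t = "(x - 1) / y"
      have "x = 1 + y * ?t"
        using that by simp
      then have "2 * a * ?t + \<beta> + y * Q ?t 1 = 0"
        using line[of y ?t] that by simp
      then have "2 * a * ?t + \<beta> = - (y * Q ?t 1)"
        by (simp only: eq_neg_iff_add_eq_0)
      then show ?thesis
        using Q1[of ?t] that unfolding l_def by (simp only: minus_minus) simp
    qed
    show "\<forall>p\<in>{(y, x). Q x y = a \<and> y \<noteq> 0}.
        (l (case p of (y, x) \<Rightarrow> (x - 1) / y), 1 + l (case p of (y, x) \<Rightarrow> (x - 1) / y) *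
          (case p of (y, x) \<Rightarrow> (x - 1) / y)) = p"
      using * by auto
    show "(\<lambda>t. (l t, 1 + l t * t)) ` ?T \<subseteq> {(y, x). Q x y = a \<and> y \<noteq> 0}"
    proof (intro image_subsetI)
      fix t assume t: "t \<in> ?T"
      have "2 * a * t + \<beta> + l t * Q t 1 = 0"
        using Q1[of t] by (simp add: l_def)
      moreover have "l t \<noteq> 0"
        using t Q1[of t] by (simp add: l_def neg_eq_iff_add_eq_0 add.commute)
      ultimately show "(l t, 1 + l t * t) \<in> {(y, x). Q x y = a \<and> y \<noteq> 0}"
        using line[of "l t" t] by simp
    qed
    show "(\<lambda>(y, x). (x - 1) / y) ` {(y, x). Q x y = a \<and> y \<noteq> 0} \<subseteq> ?T"
      using * by auto
  qed
  then have card_T: "card {(y, x). Q x y = a \<and> y \<noteq> 0} = card ?T"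
    by (simp add: bij_betw_same_card)
  \<comment> \<open>The points missed by the parametrisation are \<open>s\<close> and
    \<open>- s\<close>.\<close>
  have "Q x 0 = a \<longleftrightarrow> x = 1 \<or> x = - 1" for x
    using assms(2) power2_eq_1_iff[of x] by (simp add: Q_def)
  then have "(y, x) \<in> ?P \<longleftrightarrow> (y, x) \<in> {(0, 1), (0, - 1)} \<union> {(y, x). Q x y = a \<and> y \<noteq> 0}" for x y
    by (cases "y = 0") simp_all
  then have "?P = {(0, 1), (0, - 1)} \<union> {(y, x). Q x y = a \<and> y \<noteq> 0}"
    by (intro set_eqI) (simp only: split_paired_all)
  moreover have "finite {(y, x). Q x y = a \<and> y \<noteq> 0}"
    by (rule finite_subset[OF subset_UNIV]) (simp add: assms(4) finite_prod)
  ultimately have "card ?P = card {(0 :: 'f, 1 :: 'f), (0, -1)} + card ?T"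
    by (simp only: card_T[symmetric], intro card_Un_disjoint) auto
  also have "\<dots> = CARD('f) + 1"
  \<comment> \<open>In characteristic 2 the points \<open>s\<close> and \<open>- s\<close> coincide
    and no slope \<open>t\<close> is tangent: 1 + f. Otherwise they differ and exactly one slope is
    tangent: 2 + (f - 1).\<close>
  proof (cases "(2::'f) = 0")
    case True
    \<comment> \<open>Here b(s,s) = 2 q(s) = 0, so b(e,s) = 0 would make \<open>e\<close> and
      \<open>s\<close> both orthogonal to \<open>s\<close>, hence proportional.\<close>
    have "\<beta> \<noteq> 0"
    proof
      assume "\<beta> = 0"
      then obtain c where "e = c *s s"
        using orthogonal_proportional[of s e s] s True by (auto simp: \<beta>_def b_self)
      then show False
        using e by blast
    qed
    then have T: "?T = UNIV"
      using True by auto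
    have m: "(- 1 :: 'f) = 1"
      using True by (metis add_eq_0_iff one_add_one)
    show ?thesis
      unfolding T m by simp
  next
    case False
    then have "?T = UNIV - {- \<beta> / (2 * a)}"
      using assms(2) by (auto simp: field_simps eq_neg_iff_add_eq_0)
    moreover have "(- 1 :: 'f) \<noteq> 1"
      using False by (metis add.right_inverse one_add_one)
    moreover have "CARD('f) > 0"
      using assms(4) by (simp add: card_gt_0_iff)
    ultimately show ?thesis
      by (simp add: card_Diff_singleton)
  qed
  finally have "card ?P = CARD('f) + 1" .
  moreover have "g -` {x. q x = a} = ?P"
    using qg by auto
  moreover have "card (g -` {x. q x = a}) = card {x. q x = a}"
    using bij by (intro card_vimage_inj) (auto simp: bij_def)
  ultimately show ?thesis
    by simp
qed

section \<open>The case a = 0\<close>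

text \<open>In hyperbolic coordinates, a 4-cycle through \<open>0\<close> is either contained in one of the two
  coordinate axes, or is an axis-parallel rectangle.\<close>

lemma card_rooted_cycles_0:
  assumes "isotropic q" "finite (UNIV :: 'f set)"
  shows "card (rooted_cycles 0) =
    2 * ((CARD('f) - 1) * (CARD('f) - 2) * (CARD('f) - 3)) + 2 * (CARD('f) - 1)\<^sup>2"
proof -
  obtain u v where "bij (\<lambda>(x, y). x *s u + y *s v)" and quv: "\<And>x y. q (x *s u + y *s v) = x * y"
    using hyperbolic_basis assms(1) by blast
  define g where "g = (\<lambda>(x, y). x *s u + y *s v)"
  have "inj g" "surj g"
    using \<open>bij (\<lambda>(x, y). x *s u + y *s v)\<close> by (simp_all add: g_def bij_def)
  have g0: "g (0, 0) = 0"
    by (simp add: g_def)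
  have qg: "q (g (x, y)) = x * y" for x y
    by (simp add: g_def quv)
  have diff: "g (x, y) - g (x', y') = g (x - x', y - y')" for x y x' y'
    by (simp add: g_def scale_left_diff_distrib)
  have eq: "g p = g p' \<longleftrightarrow> p = p'" for p p'
    using \<open>inj g\<close> by (simp add: inj_eq)
  have eq0: "g (x, y) = 0 \<longleftrightarrow> x = 0 \<and> y = 0" for x y
    using eq[of "(x, y)" "(0, 0)"] g0 by auto
  let ?G = "map_prod g (map_prod g g)"
  let ?N = "UNIV - {0 :: 'f}"
  let ?D = "{(x, y, z). x \<in> ?N \<and> y \<in> ?N \<and> z \<in> ?N \<and> x \<noteq> y \<and> x \<noteq> z \<and> y \<noteq> z}"
  let ?A1 = "(\<lambda>(x, y, z). ((x, 0 :: 'f), (y, 0 :: 'f), (z, 0 :: 'f))) ` ?D"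
  let ?A2 = "(\<lambda>(x, y, z). ((0 :: 'f, x), (0 :: 'f, y), (0 :: 'f, z))) ` ?D"
  let ?B1 = "(\<lambda>(x, y). ((x, 0 :: 'f), (x, y), (0 :: 'f, y))) ` (?N \<times> ?N)"
  let ?B2 = "(\<lambda>(x, y). ((0 :: 'f, y), (x, y), (x, 0 :: 'f))) ` (?N \<times> ?N)"
  \<comment> \<open>The neighbours \<open>s\<close> and \<open>t\<close> of 0 lie on the axes. On
    the same axis, the two equations for \<open>w\<close> force \<open>w\<close> onto it as well
    (\<open>?A1\<close>, \<open>?A2\<close>). On different axes, \<open>w\<close> nonzero must be
    the opposite corner of the rectangle (\<open>?B1\<close>, \<open>?B2\<close>).\<close>
  have decomp: "?G -` rooted_cycles 0 = (?A1 \<union> ?A2) \<union> (?B1 \<union> ?B2)" (is "?L = ?R")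
  proof
    show "?L \<subseteq> ?R"
    proof
      fix p assume "p \<in> ?L"
      moreover obtain s s' w w' t t' where p: "p = ((s, s'), (w, w'), (t, t'))"
        by (metis surj_pair)
      ultimately have "s * s' = 0" "(w - s) * (w' - s') = 0" "(w - t) * (w' - t') = 0" "t * t' = 0"
        "distinct [(0, 0), (s, s'), (w, w'), (t, t')]"
        by (auto simp: rooted_cycles_def qg diff eq eq0 eq_commute[of 0])
      then show "p \<in> ?R"
        unfolding p by (auto simp: image_iff)
    qed
    show "?R \<subseteq> ?L"
      by (auto simp: rooted_cycles_def qg diff eq eq0 eq_commute[of 0])
  qed
  have vimage: "card (?G -` rooted_cycles 0) = card (rooted_cycles 0)"
    using \<open>inj g\<close> \<open>surj g\<close>
    by (intro card_vimage_inj) (auto simp: prod.inj_map map_prod_surj)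
  have fin: "finite X" for X :: "(('f \<times> 'f) \<times> ('f \<times> 'f) \<times> ('f \<times> 'f)) set"
    by (rule finite_subset[OF subset_UNIV]) (simp add: assms(2) finite_prod)
  have AB: "card ((?A1 \<union> ?A2) \<union> (?B1 \<union> ?B2)) = card (?A1 \<union> ?A2) + card (?B1 \<union> ?B2)"
    by (intro card_Un_disjoint fin) auto
  have A: "card (?A1 \<union> ?A2) = card ?A1 + card ?A2"
    by (intro card_Un_disjoint fin) auto
  have B: "card (?B1 \<union> ?B2) = card ?B1 + card ?B2"
    by (intro card_Un_disjoint fin) auto
  have cA: "card ?A1 = card ?D" "card ?A2 = card ?D"
    by (intro card_image; auto simp: inj_on_def)+
  have cB: "card ?B1 = card (?N \<times> ?N)" "card ?B2 = card (?N \<times> ?N)"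
    by (intro card_image; auto simp: inj_on_def)+
  have N: "card ?N = CARD('f) - 1"
    by (simp add: card_Diff_singleton)
  have D: "card ?D = (CARD('f) - 1) * (CARD('f) - 2) * (CARD('f) - 3)"
    using card_distinct_triples[of ?N] assms(2) by (simp add: card_Diff_singleton numeral_eq_Suc)
  have "card (rooted_cycles 0) = card ?D + card ?D + (card (?N \<times> ?N) + card (?N \<times> ?N))"
    unfolding vimage[symmetric] decomp AB A B cA cB ..
  then show ?thesis
    unfolding D card_cartesian_product N power2_eq_square by simp
qed

end

section \<open>Assembling the counts\<close>

lemma CHAR_eq_2_iff: "CHAR('f::field) = 2 \<longleftrightarrow> (2::'f) = 0"
proof -
  have "(2::'f) = 0 \<longleftrightarrow> CHAR('f) dvd 2"
    using of_nat_eq_0_iff_char_dvd[of 2, where ?'a = 'f] by simp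
  moreover have "CHAR('f) \<noteq> 1"
    by simp
  ultimately show ?thesis
    by (metis dvd_refl prime_nat_iff two_is_prime_nat)
qed

lemma six_choose_3: "6 * real (n choose 3) = real n * (real n - 1) * (real n - 2)"
proof -
  have "real (n choose 3) = (real n * (real n - 1) * (real n - 2)) / 6"
    by (simp add: binomial_gbinomial gbinomial_prod_rev numeral_eq_Suc atLeast0_lessThan_Suc field_simps)
  then show ?thesis by simp
qed

theorem theorem4p7:
  fixes scale :: "'f::finite_field \<Rightarrow> 'v::ab_group_add \<Rightarrow> 'v"
    and q :: "'v \<Rightarrow> 'f" and a :: 'f and f :: real
  assumes "vector_space scale"
    and "vector_space.dim scale UNIV = 2"
    and "quadratic_form scale q"
    and "nondegenerate q"
    and "a \<in> represented_ext q"
    and "f = real CARD('f)"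
  shows "(a \<noteq> 0 \<and> isotropic q \<longrightarrow>
            real (card (cycles (representation_graph q a) 4)) =
              (if CHAR('f) \<noteq> 2 then f\<^sup>2 * (f - 1) * (f - 3) / 8
               else f\<^sup>2 * (f - 1) * (f - 2) / 8)) \<and>
         (a \<noteq> 0 \<and> \<not> isotropic q \<longrightarrow>
            real (card (cycles (representation_graph q a) 4)) =
              (if CHAR('f) \<noteq> 2 then f\<^sup>2 * (f + 1) * (f - 1) / 8
               else f ^ 3 * (f + 1) / 8)) \<and>
         (a = 0 \<longrightarrow>
            isotropic q \<and>
            real (card (cycles (representation_graph q a) 4)) =
              f\<^sup>2 / 4 * (6 * real ((CARD('f) - 1) choose 3) + (f - 1)\<^sup>2))"
proof -
  interpret quadratic_plane scale q
    using assms by (simp add: quadratic_plane_def quadratic_plane_axioms_def)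
  have "CARD('f) \<ge> card {0 :: 'f, 1}"
    by (intro card_mono) auto
  then have f2: "CARD('f) \<ge> 2"
    by simp
  \<comment> \<open>\<open>represented q\<close> omits 0, so 0 can enter
    \<open>represented_ext q\<close> only through isotropy.\<close>
  have a0: "isotropic q" if "a = 0"
    using assms(5) that by (auto simp: represented_ext_def represented_def split: if_splits)
  have "\<exists>v::'v. v \<noteq> 0"
  proof (cases "isotropic q")
    case False
    then obtain s where "q s = a" "a \<noteq> 0"
      using assms(5) by (auto simp: represented_ext_def represented_def)
    then show ?thesis
      by (metis q_zero)
  qed (auto simp: isotropic_def)
  then have card_V: "CARD('v) = (CARD('f))\<^sup>2"
    using card_plane by blast
  then have "finite (UNIV :: 'v set)"
    using f2 by (intro card_ge_0_finite) simp
  then have count: "real (card (cycles (representation_graph q a) 4)) =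
      f\<^sup>2 * real (card (rooted_cycles a)) / 8"
  proof -
    have "8 * real (card (cycles (representation_graph q a) 4)) =
        real CARD('v) * real (card (rooted_cycles a))"
      unfolding of_nat_mult[symmetric] card_cycles_eq_rooted[OF \<open>finite UNIV\<close>, symmetric] by simp
    then show ?thesis
      by (simp add: card_V assms(6))
  qed
  have pairs: "card (rooted_cycles a) =
      card {x. q x = a} * (card {x. q x = a} - (if CHAR('f) = 2 then 1 else 2))" if "a \<noteq> 0"
    using card_rooted_cycles[OF \<open>finite UNIV\<close> that] by (simp only: CHAR_eq_2_iff)
  show ?thesis
  proof (intro conjI impI; (elim conjE)?)
    assume "a \<noteq> 0" "isotropic q"
    \<comment> \<open>The conic has f - 1 points and two are excluded, so this bound keeps the
      subtraction in \<open>pairs\<close> from truncating.\<close>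
    have "CARD('f) \<ge> 3" if "CHAR('f) \<noteq> 2"
    proof -
      have "(- 1 :: 'f) \<noteq> 1"
        using that by (metis CHAR_eq_2_iff add.right_inverse one_add_one)
      then have "card {0 :: 'f, 1, - 1} = 3"
        by auto
      then show ?thesis
        by (metis card_mono finite subset_UNIV)
    qed
    then show "real (card (cycles (representation_graph q a) 4)) =
        (if CHAR('f) \<noteq> 2 then f\<^sup>2 * (f - 1) * (f - 3) / 8 else f\<^sup>2 * (f - 1) * (f - 2) / 8)"
      using f2 assms(6) \<open>a \<noteq> 0\<close> \<open>isotropic q\<close>
      by (simp add: count pairs card_fiber_isotropic of_nat_diff)
  next
    assume "a \<noteq> 0" "\<not> isotropic q"
    moreover from this obtain s where "q s = a"
      using assms(5) by (auto simp: represented_ext_def represented_def)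
    ultimately have "card {x. q x = a} = CARD('f) + 1"
      using card_fiber_anisotropic by simp
    then show "real (card (cycles (representation_graph q a) 4)) =
        (if CHAR('f) \<noteq> 2 then f\<^sup>2 * (f + 1) * (f - 1) / 8 else f ^ 3 * (f + 1) / 8)"
      using f2 assms(6) \<open>a \<noteq> 0\<close>
      by (simp add: count pairs of_nat_diff power2_eq_square power3_eq_cube field_simps)
  next
    assume "a = 0"
    then show "isotropic q"
      by (rule a0)
  next
    assume "a = 0"
    \<comment> \<open>For f = 2 the natural number \<open>CARD('f) - 3\<close> truncates to 0 while
      f - 3 = -1, but the factor f - 2 makes both sides vanish.\<close>
    have triples: "real ((CARD('f) - 1) * (CARD('f) - 2) * (CARD('f) - 3)) = (f - 1) * (f - 2) * (f - 3)"
    proof (cases "CARD('f) = 2")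
      case False
      then show ?thesis
        using f2 assms(6) by (simp add: of_nat_diff)
    qed (simp add: assms(6))
    have rooted: "real (card (rooted_cycles a)) = 2 * ((f - 1) * (f - 2) * (f - 3)) + 2 * (f - 1)\<^sup>2"
      unfolding \<open>a = 0\<close> card_rooted_cycles_0[OF a0[OF \<open>a = 0\<close>] finite] of_nat_add triples[symmetric]
      using f2 assms(6) by (simp add: of_nat_diff)
    have choose: "6 * real ((CARD('f) - 1) choose 3) = (f - 1) * (f - 2) * (f - 3)"
      unfolding six_choose_3 using f2 assms(6) by (simp add: of_nat_diff)
    show "real (card (cycles (representation_graph q a) 4)) =
        f\<^sup>2 / 4 * (6 * real ((CARD('f) - 1) choose 3) + (f - 1)\<^sup>2)"
      unfolding count rooted choose by (simp add: field_simps)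
  qed
qed

end
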